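(* Let $K$ be a finite abstract simplicial complex with vertex set $V$, let $P$ be a finite set, let $s\ge 1$ be a natural number, and let $R$ be a nonzero commutative ring. A map $f\colon V\to P$ is a $(P,s)$-coloring of $K$ if and only if $$c(V)=\prod_{p\in P}c_{\le s}(f^{-1}(p))$$ in the Stanley--Reisner algebra $\mathrm{SR}(K;R)$.
   Context: A finite abstract simplicial complex (ASC) is a finite set $K$ of finite sets closed under formation of subsets; its vertex set $V$ is the set of all $v$ with $\{v\}\in K$. A $(P,s)$-coloring of $K$ is a map $f\colon V\to P$ such that $|\sigma\cap f^{-1}(p)|\le s$ for all $\sigma\in K$ and all $p\in P$. $R[V]$ is the polynomial $R$-algebra on the set $V$, graded with each $v\in V$ in degree $2$. The Stanley--Reisner algebra is $\mathrm{SR}(K;R)=R[V]/\left(\prod_{v\in\tau}v \mid \tau\subset V,\ \tau\notin K\right)$. For $U\subset V$, $c(U)=\prod_{u\in U}(1+u)$, and $c_{\le s}(U)$ is $c(U)$ truncated above degree $2s$, i.e. $c_{\le s}(U)=\sum_{j=0}^{s}e_j(U)$, where $e_j(U)$ is the $j$-th elementary symmetric polynomial in the variables $U$ ($e_0=1$). The same symbols denote the images of these elements in $\mathrm{SR}(K;R)$. *)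

theory Defs
  imports "HOL-Algebra.QuotRing" "HOL-Library.Poly_Mapping" "HOL-Library.FuncSet"
begin

definition simplicial_complex :: "'v set set \<Rightarrow> bool" where
  "simplicial_complex K \<longleftrightarrow>
     finite K \<and> (\<forall>\<sigma>\<in>K. finite \<sigma>) \<and> (\<forall>\<sigma>\<in>K. \<forall>\<tau>. \<tau> \<subseteq> \<sigma> \<longrightarrow> \<tau> \<in> K)"

definition vertices :: "'v set set \<Rightarrow> 'v set" where
  "vertices K = {v. {v} \<in> K}"

text \<open>The fibre of \<open>f\<close>, regarded as a map on the vertex set only; values of the HOL function
  \<open>f\<close> outside the vertex set never matter.\<close>

definition color_class :: "'v set set \<Rightarrow> ('v \<Rightarrow> 'p) \<Rightarrow> 'p \<Rightarrow> 'v set" where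
  "color_class K f p = {v \<in> vertices K. f v = p}"

definition is_coloring :: "'v set set \<Rightarrow> 'p set \<Rightarrow> nat \<Rightarrow> ('v \<Rightarrow> 'p) \<Rightarrow> bool" where
  "is_coloring K P s f \<longleftrightarrow>
     f \<in> vertices K \<rightarrow> P \<and> (\<forall>\<sigma>\<in>K. \<forall>p\<in>P. card (\<sigma> \<inter> color_class K f p) \<le> s)"

text \<open>A monomial is a finitely supported exponent vector \<open>'v \<Rightarrow>\<^sub>0 nat\<close>, and a polynomial is a
  finitely supported family of coefficients indexed by monomials, with the convolution product
  of \<open>HOL-Library.Poly_Mapping\<close>. The coefficient ring is a type of class \<open>comm_ring_1\<close>, which
  includes \<open>0 \<noteq> 1\<close>.\<close>

type_synonym ('v, 'r) mpoly = "('v \<Rightarrow>\<^sub>0 nat) \<Rightarrow>\<^sub>0 'r"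

definition var :: "'v \<Rightarrow> ('v, 'r::comm_ring_1) mpoly" where
  "var v = Poly_Mapping.single (Poly_Mapping.single v 1) 1"

definition polynomial_ring :: "'r::comm_ring_1 itself \<Rightarrow> 'v set \<Rightarrow> ('v, 'r) mpoly ring" where
  "polynomial_ring _ V =
     \<lparr>carrier = {q. \<forall>m\<in>Poly_Mapping.keys q. Poly_Mapping.keys m \<subseteq> V},
      monoid.mult = (*), one = 1, zero = 0, add = (+)\<rparr>"

definition sr_ideal :: "'v set set \<Rightarrow> 'r::comm_ring_1 itself \<Rightarrow> ('v, 'r) mpoly set" where
  "sr_ideal K R =
     genideal (polynomial_ring R (vertices K))
       {\<Prod>v\<in>\<tau>. var v | \<tau>. \<tau> \<subseteq> vertices K \<and> \<tau> \<notin> K}"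

definition SR :: "'v set set \<Rightarrow> 'r::comm_ring_1 itself \<Rightarrow> ('v, 'r) mpoly set ring" where
  "SR K R = polynomial_ring R (vertices K) Quot sr_ideal K R"

definition sr_image :: "'v set set \<Rightarrow> ('v, 'r::comm_ring_1) mpoly \<Rightarrow> ('v, 'r) mpoly set" where
  "sr_image K q = sr_ideal K TYPE('r) +>\<^bsub>polynomial_ring TYPE('r) (vertices K)\<^esub> q"

definition elem_sym :: "nat \<Rightarrow> 'v set \<Rightarrow> ('v, 'r::comm_ring_1) mpoly" where
  "elem_sym j U = (\<Sum>S | S \<subseteq> U \<and> card S = j. \<Prod>u\<in>S. var u)"

definition chern :: "'v set \<Rightarrow> ('v, 'r::comm_ring_1) mpoly" where
  "chern U = (\<Prod>u\<in>U. 1 + var u)"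

text \<open>Variables have degree 2, so truncating above degree \<open>2 * s\<close> keeps the elementary symmetric
  polynomials of index at most \<open>s\<close>.\<close>

definition chern_le :: "nat \<Rightarrow> 'v set \<Rightarrow> ('v, 'r::comm_ring_1) mpoly" where
  "chern_le s U = (\<Sum>j=0..s. elem_sym j U)"

lemma polynomial_ring_simps [simp]:
  "carrier (polynomial_ring R V) =
     {q. \<forall>m\<in>Poly_Mapping.keys q. Poly_Mapping.keys m \<subseteq> V}"
  "x \<otimes>\<^bsub>polynomial_ring R V\<^esub> y = x * y" "\<one>\<^bsub>polynomial_ring R V\<^esub> = 1"
  "x \<oplus>\<^bsub>polynomial_ring R V\<^esub> y = x + y" "\<zero>\<^bsub>polynomial_ring R V\<^esub> = 0"
  by (simp_all add: polynomial_ring_def)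

lemma polynomial_ring_add_closed:
  assumes "x \<in> carrier (polynomial_ring R V)" "y \<in> carrier (polynomial_ring R V)"
  shows "x + y \<in> carrier (polynomial_ring R V)"
  using assms Poly_Mapping.keys_add[of x y] unfolding polynomial_ring_simps by blast

lemma polynomial_ring_mult_closed:
  assumes x: "x \<in> carrier (polynomial_ring R V)" and y: "y \<in> carrier (polynomial_ring R V)"
  shows "x * y \<in> carrier (polynomial_ring R V)"
  unfolding polynomial_ring_simps
proof (intro CollectI ballI)
  fix m assume "m \<in> Poly_Mapping.keys (x * y)"
  then obtain a b
    where m: "m = a + b" "a \<in> Poly_Mapping.keys x" "b \<in> Poly_Mapping.keys y"
    using keys_mult[of x y] by blast
  have "Poly_Mapping.keys a \<subseteq> V" "Poly_Mapping.keys b \<subseteq> V"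
    using x y m(2,3) unfolding polynomial_ring_simps by blast+
  then show "Poly_Mapping.keys m \<subseteq> V"
    using Poly_Mapping.keys_add[of a b] unfolding m(1) by blast
qed

lemma cring_polynomial_ring: "cring (polynomial_ring R V)"
proof (rule cringI)
  show "abelian_group (polynomial_ring R V)"
  proof (rule abelian_groupI, goal_cases)
    case (1 x y)
    then show ?case using polynomial_ring_add_closed[of x R V y] by simp
  next
    case (6 x)
    then show ?case by (intro bexI[of _ "- x"]) simp_all
  qed (simp_all add: ac_simps)
  show "Group.comm_monoid (polynomial_ring R V)"
  proof (rule comm_monoidI, goal_cases)
    case (1 x y)
    then show ?case using polynomial_ring_mult_closed[of x R V y] by simp
  qed (simp_all add: ac_simps)
qed (simp add: distrib_right)

lemma var_prod_in_carrier:
  assumes "U \<subseteq> V"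
  shows "(\<Prod>v\<in>U. var v) \<in> carrier (polynomial_ring R V)"
  using assms
proof (induction U rule: infinite_finite_induct)
  case (insert v U)
  have "var v \<in> carrier (polynomial_ring R V)"
    using insert.prems by (simp add: var_def)
  then have "var v * (\<Prod>v\<in>U. var v) \<in> carrier (polynomial_ring R V)"
    using insert by (intro polynomial_ring_mult_closed) blast+
  then show ?case using insert.hyps by simp
qed simp_all

lemma ideal_sr_ideal: "ideal (sr_ideal K R) (polynomial_ring R (vertices K))"
  unfolding sr_ideal_def
  by (rule ring.genideal_ideal[OF cring.axioms(1)[OF cring_polynomial_ring]])
     (use var_prod_in_carrier in blast)

lemma cring_SR: "cring (SR K R)"
  unfolding SR_def
  by (rule ideal.quotient_is_cring[OF ideal_sr_ideal cring_polynomial_ring])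

end

theory Submission
  imports Defs "HOL-Library.Disjoint_Sets"
begin

text \<open>Expanded into monomials, \<open>chern V\<close> is the sum of all squarefree monomials \<open>x\<^sub>S\<close> with
  \<open>S \<subseteq> V\<close>, and the product of the truncated classes is the sum of those \<open>x\<^sub>S\<close> for which
  \<open>S\<close> contains at most \<open>s\<close> vertices of each colour. Their difference is thus the sum of the
  \<open>x\<^sub>S\<close> over the overfull sets \<open>S\<close>. The Stanley--Reisner ideal consists of the polynomials all of
  whose monomials have support outside \<open>K\<close>, so the difference lies in it iff no overfull set is
  a face. As all nonzero coefficients are \<open>1\<close>, this works over every nonzero ring.\<close>

section \<open>Expansion into squarefree monomials\<close>

text \<open>This is distributivity: because the blocks \<open>A i\<close> are disjoint, choosing one
  admissible subset in every block amounts to choosing a single subset of the union, whose pieces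
  are its traces on the blocks. The predicate \<open>Q\<close> later becomes the bound on the
  cardinality within one colour.\<close>

lemma prod_sum_disjoint:
  fixes x :: "'v \<Rightarrow> 'a::comm_semiring_1"
  assumes "finite I" "disjoint_family_on A I" "\<And>i. i \<in> I \<Longrightarrow> finite (A i)"
  shows "(\<Prod>i\<in>I. \<Sum>S | S \<subseteq> A i \<and> Q i S. \<Prod>v\<in>S. x v) =
    (\<Sum>S | S \<subseteq> (\<Union>i\<in>I. A i) \<and> (\<forall>i\<in>I. Q i (S \<inter> A i)). \<Prod>v\<in>S. x v)"
  using assms
proof (induction I rule: finite_induct)
  case empty
  have "{S. S = {}} = {{} :: 'v set}" by auto
  then show ?case by simp
next
  case (insert j I)
  let ?U = "\<Union>i\<in>I. A i"
  let ?L = "{S. S \<subseteq> A j \<and> Q j S}"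
  let ?M = "{S. S \<subseteq> ?U \<and> (\<forall>i\<in>I. Q i (S \<inter> A i))}"
  have disj: "A j \<inter> ?U = {}" and fin: "finite (A j)" "finite ?U"
    using insert by (auto simp: disjoint_family_on_def)
  have "(\<Prod>i\<in>insert j I. \<Sum>S | S \<subseteq> A i \<and> Q i S. \<Prod>v\<in>S. x v) =
      (\<Sum>S\<in>?L. \<Prod>v\<in>S. x v) * (\<Sum>S\<in>?M. \<Prod>v\<in>S. x v)"
    using insert by (simp add: disjoint_family_on_def)
  also have "\<dots> = (\<Sum>(S, T)\<in>?L \<times> ?M. (\<Prod>v\<in>S. x v) * (\<Prod>v\<in>T. x v))"
    by (simp add: sum_product sum.cartesian_product)
  also have "\<dots> = (\<Sum>(S, T)\<in>?L \<times> ?M. \<Prod>v\<in>S \<union> T. x v)"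
  proof (rule sum.cong, rule refl, clarify)
    fix S T assume "S \<subseteq> A j" "T \<subseteq> ?U"
    then show "(\<Prod>v\<in>S. x v) * (\<Prod>v\<in>T. x v) = (\<Prod>v\<in>S \<union> T. x v)"
      using disj fin by (intro prod.union_disjoint[symmetric]) (auto intro: finite_subset)
  qed
  also have "\<dots> = (\<Sum>S | S \<subseteq> (\<Union>i\<in>insert j I. A i) \<and> (\<forall>i\<in>insert j I. Q i (S \<inter> A i)).
      \<Prod>v\<in>S. x v)"
  \<comment> \<open>A pair is merged by union; cutting with \<open>A j\<close> and \<open>?U\<close>
    undoes this because the two are disjoint.\<close>
  proof (rule sum.reindex_bij_witness[where i = "\<lambda>S. (S \<inter> A j, S \<inter> ?U)"
        and j = "\<lambda>(S, T). S \<union> T"], goal_cases)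
    \<comment> \<open>The merged set is admissible: each block meets only the part of the union that
      came from its own side.\<close>
    case (2 a)
    then obtain S T where a: "a = (S, T)" "S \<subseteq> A j" "Q j S" "T \<subseteq> ?U" "\<forall>i\<in>I. Q i (T \<inter> A i)"
      by auto
    have "(S \<union> T) \<inter> A j = S" using a disj by auto
    moreover have "(S \<union> T) \<inter> A i = T \<inter> A i" if "i \<in> I" for i using a disj that by auto
    ultimately show ?case using a by auto
  next
    case (4 S)
    have "(S \<inter> ?U) \<inter> A i = S \<inter> A i" if "i \<in> I" for i using that by auto
    then show ?case using 4 by auto
  qed (use disj in auto)
  finally show ?case .
qed

lemma chern_expand:
  assumes "finite U"
  shows "chern U = (\<Sum>S | S \<subseteq> U. \<Prod>v\<in>S. var v)"
  \<comment> \<open>With the constant function 1 as second summand, the factor over the complement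
    of each chosen subset is 1.\<close>
  unfolding chern_def using prod_add[OF assms, of var "\<lambda>_. 1"]
  by (simp add: add.commute Pow_def)

lemma chern_le_expand:
  assumes "finite U"
  shows "chern_le s U = (\<Sum>S | S \<subseteq> U \<and> card S \<le> s. \<Prod>v\<in>S. var v)"
proof -
  have *: "{S. S \<subseteq> U \<and> card S \<le> s} = (\<Union>j\<in>{0..s}. {S. S \<subseteq> U \<and> card S = j})"
    by auto
  show ?thesis
    unfolding chern_le_def elem_sym_def * using assms
    by (subst sum.UNION_disjoint) auto
qed

section \<open>Squarefree monomials and their exponent vectors\<close>

text \<open>For finite \<open>S\<close> this is the indicator function of \<open>S\<close>. For
  infinite \<open>S\<close> the sum defaults to 0, in accordance with the default 1 of the product
  of variables, so \<open>prod_var_eq_single\<close> holds for every set.\<close>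

definition sqfree_exponent :: "'v set \<Rightarrow> 'v \<Rightarrow>\<^sub>0 nat" where
  "sqfree_exponent S = (\<Sum>v\<in>S. Poly_Mapping.single v 1)"

lemma keys_sqfree_exponent:
  assumes "finite S"
  shows "Poly_Mapping.keys (sqfree_exponent S) = S"
  using assms
  by (auto simp: sqfree_exponent_def in_keys_iff lookup_sum lookup_single when_def split: if_splits)

lemma prod_var_eq_single:
  "(\<Prod>v\<in>S. var v) = Poly_Mapping.single (sqfree_exponent S) 1"
  by (induction S rule: infinite_finite_induct)
    (auto simp: sqfree_exponent_def var_def mult_single)

text \<open>Nothing cancels: distinct sets give distinct monomials, so every coefficient is 0 or 1.
  Here the condition that 1 differs from 0 in the coefficient ring enters.\<close>

lemma keys_sum_prod_var:
  assumes "finite B" "\<And>S. S \<in> B \<Longrightarrow> finite S"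
  shows "Poly_Mapping.keys (\<Sum>S\<in>B. \<Prod>v\<in>S. var v :: ('v, 'r::comm_ring_1) mpoly) =
    sqfree_exponent ` B"
proof -
  \<comment> \<open>A finite set is recovered from its exponent vector as the support.\<close>
  have inj: "inj_on sqfree_exponent B"
    by (rule inj_onI) (metis assms(2) keys_sqfree_exponent)
  have "Poly_Mapping.lookup (\<Sum>S\<in>B. \<Prod>v\<in>S. var v :: ('v, 'r) mpoly) m =
      (if m \<in> sqfree_exponent ` B then 1 else 0)" for m
  proof -
    have "Poly_Mapping.lookup (\<Sum>S\<in>B. \<Prod>v\<in>S. var v :: ('v, 'r) mpoly) m =
        (\<Sum>S\<in>B. if sqfree_exponent S = m then 1 else 0)"
      by (simp add: lookup_sum prod_var_eq_single lookup_single when_def)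
    also have "\<dots> = (\<Sum>n\<in>sqfree_exponent ` B. if n = m then 1 else 0)"
      by (simp add: sum.reindex[OF inj])
    finally show ?thesis using assms by simp
  qed
  then show ?thesis by (auto simp: in_keys_iff split: if_splits)
qed

section \<open>Ring record operations as type class operations\<close>

lemma polynomial_ring_minus:
  assumes "a \<in> carrier (polynomial_ring R V)" "b \<in> carrier (polynomial_ring R V)"
  shows "a \<ominus>\<^bsub>polynomial_ring R V\<^esub> b = a - b"
proof -
  interpret cring "polynomial_ring R V" by (rule cring_polynomial_ring)
  have "\<ominus>\<^bsub>polynomial_ring R V\<^esub> b = - b"
    using assms(2) by (intro minus_equality) simp_all
  then show ?thesis by (simp add: minus_eq)
qed

lemma polynomial_ring_finprod:
  assumes "\<And>i. i \<in> I \<Longrightarrow> g i \<in> carrier (polynomial_ring R V)"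
  shows "(\<Otimes>\<^bsub>polynomial_ring R V\<^esub>i\<in>I. g i) = (\<Prod>i\<in>I. g i)"
  using assms
proof (induction I rule: infinite_finite_induct)
  case (insert i I)
  interpret cring "polynomial_ring R V" by (rule cring_polynomial_ring)
  have "(\<Otimes>\<^bsub>polynomial_ring R V\<^esub>i\<in>insert i I. g i) =
      g i \<otimes>\<^bsub>polynomial_ring R V\<^esub> (\<Otimes>\<^bsub>polynomial_ring R V\<^esub>i\<in>I. g i)"
    using insert.hyps insert.prems by (intro finprod_insert) blast+
  moreover have "(\<Otimes>\<^bsub>polynomial_ring R V\<^esub>i\<in>I. g i) = (\<Prod>i\<in>I. g i)"
    using insert by blast
  ultimately show ?case using insert.hyps by simp
next
  \<comment> \<open>Both products default to 1 over an infinite index set.\<close>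
  case (infinite I)
  interpret cring "polynomial_ring R V" by (rule cring_polynomial_ring)
  show ?case using infinite finprod_infinite[of I g] by simp
next
  case empty
  interpret cring "polynomial_ring R V" by (rule cring_polynomial_ring)
  show ?case using finprod_empty[of g] by simp
qed

lemma sum_in_polynomial_ring:
  assumes "\<And>i. i \<in> I \<Longrightarrow> g i \<in> carrier (polynomial_ring R V)"
  shows "(\<Sum>i\<in>I. g i) \<in> carrier (polynomial_ring R V)"
  using assms keys_sum[of g I] unfolding polynomial_ring_simps by blast

lemma sum_prod_var_in_polynomial_ring:
  assumes "\<And>S. S \<in> B \<Longrightarrow> S \<subseteq> V"
  shows "(\<Sum>S\<in>B. \<Prod>v\<in>S. var v) \<in> carrier (polynomial_ring R V)"
  using assms by (intro sum_in_polynomial_ring var_prod_in_carrier)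

section \<open>Membership in the Stanley--Reisner ideal\<close>

text \<open>Multiplication by a monomial can only enlarge a support, and since \<open>K\<close> is
  closed under subsets, a set containing a nonface is a nonface. The ideal serves as an upper bound
  for \<open>sr_ideal\<close>.\<close>

lemma nonface_polynomials_ideal:
  fixes R :: "'r::comm_ring_1 itself" and K :: "'v set set"
  assumes "\<And>\<sigma> \<tau>. \<sigma> \<in> K \<Longrightarrow> \<tau> \<subseteq> \<sigma> \<Longrightarrow> \<tau> \<in> K"
  shows "ideal {q \<in> carrier (polynomial_ring R V). \<forall>m\<in>Poly_Mapping.keys q. Poly_Mapping.keys m \<notin> K}
    (polynomial_ring R V)" (is "ideal ?J ?P")
proof -
  interpret cring ?P by (rule cring_polynomial_ring)
  have mult: "a * b \<in> ?J" if a: "a \<in> ?J" and b: "b \<in> carrier ?P" for a b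
  proof -
    have "Poly_Mapping.keys m \<notin> K" if "m \<in> Poly_Mapping.keys (a * b)" for m
    proof -
      from that obtain m1 m2 where m: "m = m1 + m2" "m1 \<in> Poly_Mapping.keys a"
        using keys_mult[of a b] by blast
      \<comment> \<open>Exponents are natural numbers, so adding \<open>m2\<close> cannot cancel any
        exponent of \<open>m1\<close>.\<close>
      have "Poly_Mapping.keys m1 \<subseteq> Poly_Mapping.keys m"
        by (auto simp: m(1) in_keys_iff lookup_add)
      moreover have "Poly_Mapping.keys m1 \<notin> K" using a m(2) by blast
      ultimately show ?thesis using assms by blast
    qed
    moreover have "a * b \<in> carrier ?P" using a b polynomial_ring_mult_closed by blast
    ultimately show ?thesis by blast
  qed
  have add: "a + b \<in> ?J" if "a \<in> ?J" "b \<in> ?J" for a b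
    using that polynomial_ring_add_closed[of a R V b] Poly_Mapping.keys_add[of a b] by blast
  have neg: "\<ominus>\<^bsub>?P\<^esub> a = - a" if "a \<in> ?J" for a
    using that by (intro minus_equality) simp_all
  show ?thesis
  proof (rule idealI)
    show "ring ?P" by (rule ring_axioms)
    show "subgroup ?J (add_monoid ?P)"
    proof (rule add.subgroupI)
      show "?J \<noteq> {}" by (rule ex_in_conv[THEN iffD1], rule exI[of _ 0]) simp
    next
      fix a assume "a \<in> ?J"
      then show "\<ominus>\<^bsub>?P\<^esub> a \<in> ?J" using neg by simp
    next
      fix a b assume "a \<in> ?J" "b \<in> ?J"
      then show "a \<oplus>\<^bsub>?P\<^esub> b \<in> ?J" using add[of a b] by simp
    qed blast
  next
    fix a x assume "a \<in> ?J" "x \<in> carrier ?P"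
    then show "x \<otimes>\<^bsub>?P\<^esub> a \<in> ?J" "a \<otimes>\<^bsub>?P\<^esub> x \<in> ?J"
      using mult[of a x] by (simp_all add: mult.commute)
  qed
qed

text \<open>If the sum lies in the ideal, then it lies in the larger ideal of nonface polynomials;
  as its monomials do not cancel, each of them has a nonface as support. Conversely, if
  \<open>B\<close> avoids \<open>K\<close>, every summand is a generator.\<close>

lemma sum_prod_var_mem_sr_ideal_iff:
  fixes R :: "'r::comm_ring_1 itself"
  assumes K: "simplicial_complex K" and fin: "finite (vertices K)"
    and B: "\<And>S. S \<in> B \<Longrightarrow> S \<subseteq> vertices K"
  shows "(\<Sum>S\<in>B. \<Prod>v\<in>S. var v) \<in> sr_ideal K R \<longleftrightarrow> B \<inter> K = {}"
proof -
  let ?P = "polynomial_ring R (vertices K)"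
  let ?gens = "{\<Prod>v\<in>\<tau>. var v | \<tau>. \<tau> \<subseteq> vertices K \<and> \<tau> \<notin> K} :: ('a, 'r) mpoly set"
  let ?J = "{q \<in> carrier ?P. \<forall>m\<in>Poly_Mapping.keys q. Poly_Mapping.keys m \<notin> K}"
  interpret cring ?P by (rule cring_polynomial_ring)
  interpret I: ideal "sr_ideal K R" ?P by (rule ideal_sr_ideal)
  have finB: "finite B" and finS: "\<And>S. S \<in> B \<Longrightarrow> finite S"
    using B fin by (auto intro: finite_subset[of B "Pow (vertices K)"] finite_subset)
  show ?thesis
  proof
    assume mem: "(\<Sum>S\<in>B. \<Prod>v\<in>S. var v) \<in> sr_ideal K R"
    have "?gens \<subseteq> ?J"
    proof
      fix q assume "q \<in> ?gens"
      then obtain \<tau> where \<tau>: "q = (\<Prod>v\<in>\<tau>. var v)" "\<tau> \<subseteq> vertices K" "\<tau> \<notin> K" by blast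
      have "finite \<tau>" using \<tau>(2) fin by (rule finite_subset)
      then have "\<forall>m\<in>Poly_Mapping.keys q. Poly_Mapping.keys m \<notin> K"
        using \<tau>(1,3) by (auto simp: prod_var_eq_single keys_sqfree_exponent)
      then show "q \<in> ?J" using var_prod_in_carrier[OF \<tau>(2)] \<tau>(1) by blast
    qed
    moreover have "ideal ?J ?P"
      using K by (intro nonface_polynomials_ideal) (auto simp: simplicial_complex_def)
    ultimately have "sr_ideal K R \<subseteq> ?J"
      unfolding sr_ideal_def by (intro genideal_minimal)
    then have "\<forall>m\<in>sqfree_exponent ` B. Poly_Mapping.keys m \<notin> K"
      using mem keys_sum_prod_var[where 'r='r, OF finB finS] by blast
    then show "B \<inter> K = {}" using finS by (auto simp: keys_sqfree_exponent)
  next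
    assume "B \<inter> K = {}"
    moreover have "?gens \<subseteq> carrier ?P" using var_prod_in_carrier by blast
    ultimately have gen: "(\<Prod>v\<in>S. var v) \<in> sr_ideal K R" if "S \<in> B" for S
      unfolding sr_ideal_def using genideal_self B that by blast
    have "(\<Sum>S\<in>C. \<Prod>v\<in>S. var v) \<in> sr_ideal K R" if "finite C" "C \<subseteq> B" for C
      using that
    proof (induction C rule: finite_induct)
      case empty
      show ?case using I.zero_closed by simp
    next
      case (insert S C)
      then show ?case using I.a_closed[OF gen[of S]] by simp
    qed
    then show "(\<Sum>S\<in>B. \<Prod>v\<in>S. var v) \<in> sr_ideal K R" using finB by blast
  qed
qed

section \<open>The quotient map\<close>

text \<open>The quotient map is a homomorphism of commutative rings, so the product in the theorem
  can be computed among polynomials before passing to cosets.\<close>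

lemma sr_image_prod:
  fixes g :: "'p \<Rightarrow> ('v, 'r::comm_ring_1) mpoly"
  assumes "\<And>i. i \<in> I \<Longrightarrow> g i \<in> carrier (polynomial_ring TYPE('r) (vertices K))"
  shows "(\<Otimes>\<^bsub>SR K TYPE('r)\<^esub>i\<in>I. sr_image K (g i)) = sr_image K (\<Prod>i\<in>I. g i)"
proof -
  let ?P = "polynomial_ring TYPE('r) (vertices K)"
  interpret I: ideal "sr_ideal K TYPE('r)" ?P by (rule ideal_sr_ideal)
  interpret ring_hom_cring ?P "SR K TYPE('r)" "sr_image K"
    using I.rcos_ring_hom cring_polynomial_ring cring_SR
    by (intro ring_hom_cring.intro ring_hom_cring_axioms.intro)
      (simp_all add: SR_def sr_image_def[abs_def])
  have "sr_image K (\<Otimes>\<^bsub>?P\<^esub>i\<in>I. g i) = (\<Otimes>\<^bsub>SR K TYPE('r)\<^esub>i\<in>I. sr_image K (g i))"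
    using assms hom_finprod[of g I] by (simp add: comp_def Pi_def)
  then show ?thesis using assms by (simp add: polynomial_ring_finprod)
qed

text \<open>Turns the equation in \<open>SR\<close> into an ideal membership problem for an ordinary
  difference of polynomials.\<close>

lemma sr_image_eq_iff:
  fixes a b :: "('v, 'r::comm_ring_1) mpoly"
  assumes "a \<in> carrier (polynomial_ring TYPE('r) (vertices K))"
    and "b \<in> carrier (polynomial_ring TYPE('r) (vertices K))"
  shows "sr_image K a = sr_image K b \<longleftrightarrow> a - b \<in> sr_ideal K TYPE('r)"
  using ring.quotient_eq_iff_same_a_r_cos[OF cring.axioms(1)[OF cring_polynomial_ring] ideal_sr_ideal assms]
  by (simp only: polynomial_ring_minus[OF assms] sr_image_def)

lemma finite_vertices:
  assumes "simplicial_complex K"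
  shows "finite (vertices K)"
proof -
  \<comment> \<open>The vertex set is the preimage of the finite set \<open>K\<close> under the
    injective map sending \<open>v\<close> to its singleton.\<close>
  have "finite ((\<lambda>v. {v}) -` K)"
    using assms by (intro finite_vimageI) (auto simp: simplicial_complex_def inj_on_def)
  then show ?thesis by (simp add: vertices_def vimage_def)
qed

lemma face_subset_vertices:
  assumes "simplicial_complex K" "\<sigma> \<in> K"
  shows "\<sigma> \<subseteq> vertices K"
  using assms by (auto simp: simplicial_complex_def vertices_def)

theorem theorem1p1:
  fixes K :: "'v set set" and P :: "'p set" and s :: nat and f :: "'v \<Rightarrow> 'p"
  assumes "simplicial_complex K"
    and "finite P"
    and "s \<ge> 1"
    and "f \<in> vertices K \<rightarrow> P"
  shows "is_coloring K P s f \<longleftrightarrow>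
    sr_image K (chern (vertices K)) =
      (\<Otimes>\<^bsub>SR K TYPE('r::comm_ring_1)\<^esub> p\<in>P. sr_image K (chern_le s (color_class K f p)))"
proof -
  let ?V = "vertices K"
  let ?P = "polynomial_ring TYPE('r) ?V"
  let ?x = "\<lambda>S. \<Prod>v\<in>S. var v :: ('v, 'r) mpoly"
  \<comment> \<open>\<open>G\<close> indexes the monomials of the truncated product and
    \<open>B\<close> those of the difference. Both range over all sets of vertices, so faces enter
    only through the intersection of \<open>B\<close> with \<open>K\<close>.\<close>
  define G where "G = {S. S \<subseteq> ?V \<and> (\<forall>p\<in>P. card (S \<inter> color_class K f p) \<le> s)}"
  define B where "B = {S. S \<subseteq> ?V} - G"
  have fin: "finite ?V" using assms(1) by (rule finite_vertices)
  have class_sub: "color_class K f p \<subseteq> ?V" for p by (auto simp: color_class_def)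
  have fin_class: "finite (color_class K f p)" for p using class_sub fin by (rule finite_subset)
  \<comment> \<open>Since \<open>f\<close> takes its values in \<open>P\<close>, no vertex is missed
    by the colour classes.\<close>
  have union: "(\<Union>p\<in>P. color_class K f p) = ?V"
    using assms(4) by (auto simp: color_class_def)
  have prod: "(\<Prod>p\<in>P. chern_le s (color_class K f p)) = sum ?x G"
    unfolding chern_le_expand[OF fin_class] G_def union[symmetric]
    by (rule prod_sum_disjoint)
      (use assms(2) fin_class in \<open>auto simp: disjoint_family_on_def color_class_def\<close>)
  have diff: "chern ?V - sum ?x G = sum ?x B"
    unfolding chern_expand[OF fin] B_def using fin
    by (subst sum_diff) (auto simp: G_def)
  have carr_G: "sum ?x G \<in> carrier ?P" and carr_V: "chern ?V \<in> carrier ?P"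
    unfolding chern_expand[OF fin] by (rule sum_prod_var_in_polynomial_ring; simp add: G_def)+
  have carr_class: "chern_le s (color_class K f p) \<in> carrier ?P" for p
    unfolding chern_le_expand[OF fin_class]
    by (rule sum_prod_var_in_polynomial_ring) (use class_sub in blast)
  have "sr_image K (chern ?V) =
      (\<Otimes>\<^bsub>SR K TYPE('r)\<^esub> p\<in>P. sr_image K (chern_le s (color_class K f p))) \<longleftrightarrow>
      sum ?x B \<in> sr_ideal K TYPE('r)"
    by (simp only: sr_image_prod[OF carr_class] prod sr_image_eq_iff[OF carr_V carr_G] diff)
  also have "\<dots> \<longleftrightarrow> B \<inter> K = {}"
    by (rule sum_prod_var_mem_sr_ideal_iff[OF assms(1) fin]) (simp add: B_def)
  also have "\<dots> \<longleftrightarrow> is_coloring K P s f"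
  proof -
    \<comment> \<open>Every face is a set of vertices, so the guard on \<open>\<sigma>\<close>
      disappears and the colouring condition remains.\<close>
    have "B \<inter> K = {} \<longleftrightarrow> (\<forall>\<sigma>\<in>K. \<sigma> \<subseteq> ?V \<longrightarrow> (\<forall>p\<in>P. card (\<sigma> \<inter> color_class K f p) \<le> s))"
      unfolding B_def G_def by blast
    then show ?thesis
      using face_subset_vertices[OF assms(1)] assms(4) by (simp add: is_coloring_def)
  qed
  finally show ?thesis by blast
qed

end
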